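(* For every $n\ge5$, the group $G_n$ is isomorphic to the symmetric group $S_n$.
   Context: Let $K_n=\{\boldsymbol{\lambda}=(\lambda_1,\dots,\lambda_{n-3})\in\mathbb C^{n-3}\mid \lambda_i\ne 0,1,\ \lambda_i\ne\lambda_j\ \text{for all } i\neq j\}$. For $\boldsymbol\lambda\in K_n$ put $z_1^{\boldsymbol\lambda}=0$, $z_2^{\boldsymbol\lambda}=1$, $z_3^{\boldsymbol\lambda}=\infty$, $z_{i+3}^{\boldsymbol\lambda}=\lambda_i$ for $1\le i\le n-3$. For $\sigma\in S_n$ let $f_\sigma^{\boldsymbol\lambda}$ be the unique Möbius transformation with $f_\sigma^{\boldsymbol\lambda}(z^{\boldsymbol\lambda}_{\sigma^{-1}(1)})=0$, $f_\sigma^{\boldsymbol\lambda}(z^{\boldsymbol\lambda}_{\sigma^{-1}(2)})=1$, $f_\sigma^{\boldsymbol\lambda}(z^{\boldsymbol\lambda}_{\sigma^{-1}(3)})=\infty$. Define $g_\sigma:K_n\to K_n$ by $g_\sigma(\boldsymbol\lambda)=(f_\sigma^{\boldsymbol\lambda}(z^{\boldsymbol\lambda}_{\sigma^{-1}(4)}),\dots,f_\sigma^{\boldsymbol\lambda}(z^{\boldsymbol\lambda}_{\sigma^{-1}(n)}))$. Then $G_n=\{g_\sigma\mid\sigma\in S_n\}$, a group of bijections of $K_n$ under composition. *)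

theory Defs
  imports "HOL-Analysis.Complex_Transcendental" "HOL-Algebra.Bij" "HOL-Algebra.Sym_Groups"
begin

text \<open>
  The Riemann sphere; \<open>None\<close> is the point at infinity.
\<close>
type_synonym riemann_sphere = "complex option"

definition sphere_moebius :: "complex \<Rightarrow> complex \<Rightarrow> complex \<Rightarrow> complex \<Rightarrow> riemann_sphere \<Rightarrow> riemann_sphere" where
  "sphere_moebius a b c d w =
     (case w of
        Some z \<Rightarrow> if c * z + d = 0 then None else Some (moebius a b c d z)
      | None \<Rightarrow> if c = 0 then None else Some (a / c))"

definition is_moebius :: "(riemann_sphere \<Rightarrow> riemann_sphere) \<Rightarrow> bool" where
  "is_moebius f \<longleftrightarrow> (\<exists>a b c d. a * d - b * c \<noteq> 0 \<and> f = sphere_moebius a b c d)"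

text \<open>
  A point of \<open>\<complex>\<^sup>n\<^sup>-\<^sup>3\<close> is an extensional function on \<open>{1..n-3}\<close>, so that equality of functions
  is equality of tuples. Only \<open>n \<ge> 3\<close> is meaningful.
\<close>
definition K_space :: "nat \<Rightarrow> (nat \<Rightarrow> complex) set" where
  "K_space n = {l \<in> {1..n-3} \<rightarrow>\<^sub>E UNIV.
            (\<forall>i\<in>{1..n-3}. l i \<noteq> 0 \<and> l i \<noteq> 1) \<and>
            (\<forall>i\<in>{1..n-3}. \<forall>j\<in>{1..n-3}. i \<noteq> j \<longrightarrow> l i \<noteq> l j)}"

definition z_point :: "(nat \<Rightarrow> complex) \<Rightarrow> nat \<Rightarrow> riemann_sphere" where
  "z_point l i = (if i = 1 then Some 0 else if i = 2 then Some 1 else if i = 3 then None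
            else Some (l (i - 3)))"

text \<open>
  \<open>inv_into UNIV \<sigma>\<close> is the inverse permutation; the notation \<open>inv\<close> is taken by
  inverses in groups.
\<close>
definition f_moebius :: "(nat \<Rightarrow> nat) \<Rightarrow> (nat \<Rightarrow> complex) \<Rightarrow> riemann_sphere \<Rightarrow> riemann_sphere" where
  "f_moebius \<sigma> l = (THE h. is_moebius h \<and>
              h (z_point l (inv_into UNIV \<sigma> 1)) = Some 0 \<and>
              h (z_point l (inv_into UNIV \<sigma> 2)) = Some 1 \<and>
              h (z_point l (inv_into UNIV \<sigma> 3)) = None)"

text \<open>
  For \<open>l \<in> K_space n\<close> and \<open>\<sigma>\<close> a permutation of \<open>{1..n}\<close>, the points \<open>z_point l 1, \<dots>, z_point l n\<close> are distinct and
  \<open>f_moebius \<sigma> l\<close> is injective, so \<open>the\<close> is only applied to finite points. Outside \<open>K_space n\<close> the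
  map \<open>g_map n \<sigma>\<close> is \<open>undefined\<close>, as required for membership in \<open>Bij (K_space n)\<close>.
\<close>
definition g_map :: "nat \<Rightarrow> (nat \<Rightarrow> nat) \<Rightarrow> (nat \<Rightarrow> complex) \<Rightarrow> (nat \<Rightarrow> complex)" where
  "g_map n \<sigma> = (\<lambda>l\<in>K_space n. \<lambda>i\<in>{1..n-3}. the (f_moebius \<sigma> l (z_point l (inv_into UNIV \<sigma> (i + 3)))))"

definition G_set :: "nat \<Rightarrow> ((nat \<Rightarrow> complex) \<Rightarrow> (nat \<Rightarrow> complex)) set" where
  "G_set n = {g_map n \<sigma> | \<sigma>. \<sigma> permutes {1..n}}"

definition G_group :: "nat \<Rightarrow> ((nat \<Rightarrow> complex) \<Rightarrow> (nat \<Rightarrow> complex)) monoid" where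
  "G_group n = (BijGroup (K_space n))\<lparr>carrier := G_set n\<rparr>"

end

theory Submission
  imports Defs
begin

text \<open>
  The map \<open>g_map n \<sigma>\<close> is the action of \<open>\<sigma>\<close> on ordered \<open>n\<close>-tuples of distinct points of the sphere
  by permuting the entries, seen modulo Moebius transformations. Since these act sharply
  3-transitively on the sphere, every such tuple is congruent to exactly one tuple that starts with
  \<open>0, 1, \<infinity>\<close>, that is, to \<open>z_point m\<close> for exactly one \<open>m \<in> K_space n\<close> (\<open>normal_form_exists\<close>,
  \<open>normal_form_unique\<close>), and \<open>g_map n \<sigma> l\<close> is the normal form of \<open>z_point l\<close> precomposed with the
  inverse of \<open>\<sigma>\<close> (\<open>g_map_normal_form\<close>). Uniqueness of normal forms turns \<open>\<sigma> \<mapsto> g_map n \<sigma>\<close> into a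
  homomorphism from the symmetric group to the group of bijections of \<open>K_space n\<close>, with image
  \<open>G_set n\<close>.

  It remains to see that the kernel is trivial. If \<open>\<sigma>\<close> is in the kernel and \<open>w\<close> is its inverse, then
  every injective tuple \<open>c\<close>, not only those in normal form, is congruent to \<open>c \<circ> w\<close>. Suppose that
  \<open>q = w p \<noteq> p\<close>, and let \<open>c'\<close> be \<open>c\<close> with only the entry at \<open>q\<close> changed. The transformations \<open>f\<close> and
  \<open>f'\<close> that take \<open>c\<close> to \<open>c \<circ> w\<close> and \<open>c'\<close> to \<open>c' \<circ> w\<close> agree at \<open>c i\<close> for each of the \<open>n - 2\<close> indices
  \<open>i \<noteq> p, q\<close>. Here \<open>n \<ge> 5\<close> enters: these are at least three points, so \<open>f = f'\<close>. But at
  \<open>c p = c' p\<close> they take the values \<open>c q\<close> and \<open>c' q\<close>, which differ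
  (\<open>moebius_congruent_faithful\<close>). For \<open>n = 4\<close> the argument breaks down, as it must: the double
  transpositions preserve the cross ratio.
\<close>

section \<open>Moebius transformations in homogeneous coordinates\<close>

text \<open>
  The point of the sphere with homogeneous coordinates \<open>[x : y]\<close>. In these coordinates a Moebius
  transformation is multiplication by a \<open>2 \<times> 2\<close> matrix, so infinity needs no separate treatment in
  the algebra below.
\<close>

definition sphere_ratio :: "complex \<Rightarrow> complex \<Rightarrow> riemann_sphere" where
  "sphere_ratio x y = (if y = 0 then None else Some (x / y))"

lemma sphere_ratio_cases:
  obtains x y where "w = sphere_ratio x y" "x \<noteq> 0 \<or> y \<noteq> 0"
proof (cases w)
  case None
  then show ?thesis using that[of 1 0] by (simp add: sphere_ratio_def)
next
  case (Some z)
  then show ?thesis using that[of z 1] by (simp add: sphere_ratio_def)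
qed

lemma sphere_ratio_eq_iff:
  assumes "x \<noteq> 0 \<or> y \<noteq> 0" "x' \<noteq> 0 \<or> y' \<noteq> 0"
  shows "sphere_ratio x y = sphere_ratio x' y' \<longleftrightarrow> x * y' = x' * y"
  using assms by (auto simp: sphere_ratio_def field_simps)

lemma sphere_moebius_ratio:
  assumes "a * d - b * c \<noteq> 0" "x \<noteq> 0 \<or> y \<noteq> 0"
  shows "sphere_moebius a b c d (sphere_ratio x y) = sphere_ratio (a * x + b * y) (c * x + d * y)"
proof (cases "y = 0")
  case True
  then show ?thesis using assms by (auto simp: sphere_moebius_def sphere_ratio_def)
next
  case False
  have "c * (x / y) + d = (c * x + d * y) / y" "a * (x / y) + b = (a * x + b * y) / y"
    using False by (auto simp: field_simps)
  then show ?thesis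
    using False by (simp add: sphere_moebius_def sphere_ratio_def moebius_def)
qed

lemma invertible_matrix_nonzero:
  fixes a b c d x y :: complex
  assumes "a * d - b * c \<noteq> 0" "x \<noteq> 0 \<or> y \<noteq> 0"
  shows "a * x + b * y \<noteq> 0 \<or> c * x + d * y \<noteq> 0"
proof (rule ccontr)
  assume "\<not> ?thesis"
  then have "a * x + b * y = 0" "c * x + d * y = 0" by auto
  then have "(a * d - b * c) * x = 0" "(a * d - b * c) * y = 0" by algebra+
  with assms show False by auto
qed

lemma is_moebius_comp:
  assumes "is_moebius f" "is_moebius g"
  shows "is_moebius (f \<circ> g)"
proof -
  obtain a b c d where f: "a * d - b * c \<noteq> 0" "f = sphere_moebius a b c d"
    using assms(1) unfolding is_moebius_def by blast
  obtain a' b' c' d' where g: "a' * d' - b' * c' \<noteq> 0" "g = sphere_moebius a' b' c' d'"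
    using assms(2) unfolding is_moebius_def by blast
  let ?A = "a * a' + b * c'" and ?B = "a * b' + b * d'"
  let ?C = "c * a' + d * c'" and ?D = "c * b' + d * d'"
  have "?A * ?D - ?B * ?C = (a * d - b * c) * (a' * d' - b' * c')"
    by (simp add: algebra_simps)
  then have det: "?A * ?D - ?B * ?C \<noteq> 0" using f(1) g(1) by simp
  have "(f \<circ> g) w = sphere_moebius ?A ?B ?C ?D w" for w
  proof -
    obtain x y where w: "w = sphere_ratio x y" "x \<noteq> 0 \<or> y \<noteq> 0" by (rule sphere_ratio_cases)
    have "(f \<circ> g) w = sphere_ratio (a * (a' * x + b' * y) + b * (c' * x + d' * y))
                                   (c * (a' * x + b' * y) + d * (c' * x + d' * y))"
      using w sphere_moebius_ratio[OF g(1) w(2)]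
        sphere_moebius_ratio[OF f(1) invertible_matrix_nonzero[OF g(1) w(2)]]
      by (simp add: f(2) g(2))
    also have "\<dots> = sphere_ratio (?A * x + ?B * y) (?C * x + ?D * y)"
      by (rule arg_cong2[where f = sphere_ratio]) (simp_all add: algebra_simps)
    finally show ?thesis using w sphere_moebius_ratio[OF det w(2)] by simp
  qed
  then show ?thesis unfolding is_moebius_def using det by blast
qed

lemma sphere_moebius_scalar:
  assumes "k \<noteq> 0"
  shows "sphere_moebius k 0 0 k = id"
  using assms by (auto simp: fun_eq_iff sphere_moebius_def moebius_def split: option.splits)

lemma is_moebius_id: "is_moebius id"
  unfolding is_moebius_def using sphere_moebius_scalar[of 1]
  by (intro exI[of _ 1] exI[of _ 0]) simp

text \<open>The inverse comes from the adjugate matrix.\<close>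

lemma is_moebius_inverse:
  assumes "is_moebius f"
  obtains g where "is_moebius g" "g \<circ> f = id"
proof -
  obtain a b c d where f: "a * d - b * c \<noteq> 0" "f = sphere_moebius a b c d"
    using assms unfolding is_moebius_def by blast
  let ?g = "sphere_moebius d (- b) (- c) a"
  have det: "d * a - (- b) * (- c) \<noteq> 0" using f(1) by (simp add: algebra_simps)
  have "(?g \<circ> f) w = id w" for w
  proof -
    obtain x y where w: "w = sphere_ratio x y" "x \<noteq> 0 \<or> y \<noteq> 0" by (rule sphere_ratio_cases)
    note ne = invertible_matrix_nonzero[OF f(1) w(2)]
    have "(?g \<circ> f) w = sphere_ratio (d * (a * x + b * y) + (- b) * (c * x + d * y))
                                    ((- c) * (a * x + b * y) + a * (c * x + d * y))"
      using w sphere_moebius_ratio[OF f(1) w(2)] sphere_moebius_ratio[OF det ne]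
      by (simp add: f(2))
    also have "\<dots> = sphere_ratio ((a * d - b * c) * x) ((a * d - b * c) * y)"
      by (rule arg_cong2[where f = sphere_ratio]) (simp_all add: algebra_simps)
    also have "\<dots> = w" using f(1) w by (simp add: sphere_ratio_def)
    finally show ?thesis by simp
  qed
  moreover have "is_moebius ?g" unfolding is_moebius_def using det by blast
  ultimately show ?thesis using that by blast
qed

lemma is_moebius_inj:
  assumes "is_moebius f"
  shows "inj f"
proof -
  obtain g where "g \<circ> f = id" using is_moebius_inverse[OF assms] by blast
  then show ?thesis by (metis inj_on_id inj_on_imageI2)
qed

lemma is_moebius_fixing_0_1_inf:
  assumes "is_moebius f" "f (Some 0) = Some 0" "f (Some 1) = Some 1" "f None = None"
  shows "f = id"
proof -
  obtain a b c d where f: "a * d - b * c \<noteq> 0" "f = sphere_moebius a b c d"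
    using assms(1) unfolding is_moebius_def by blast
  have c: "c = 0" using assms(4) f(2) by (auto simp: sphere_moebius_def split: if_splits)
  then have d: "d \<noteq> 0" using f(1) by auto
  have b: "b = 0" using assms(2) f(2) c d by (simp add: sphere_moebius_def moebius_def)
  have "a = d" using assms(3) f(2) b c d by (simp add: sphere_moebius_def moebius_def)
  then show ?thesis using sphere_moebius_scalar[OF d] f(2) b c by simp
qed

text \<open>
  In homogeneous coordinates the determinants \<open>x\<^sub>i y\<^sub>j - x\<^sub>j y\<^sub>i\<close> vanish exactly when two points
  coincide, so the cross ratio \<open>(z - p) (q - r) / ((z - r) (q - p))\<close> is given by an invertible
  matrix, whichever of the points is infinite.
\<close>

lemma is_moebius_normalize:
  assumes "p \<noteq> q" "q \<noteq> r" "p \<noteq> r"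
  obtains f where "is_moebius f" "f p = Some 0" "f q = Some 1" "f r = None"
proof -
  obtain x1 y1 where p: "p = sphere_ratio x1 y1" "x1 \<noteq> 0 \<or> y1 \<noteq> 0" by (rule sphere_ratio_cases)
  obtain x2 y2 where q: "q = sphere_ratio x2 y2" "x2 \<noteq> 0 \<or> y2 \<noteq> 0" by (rule sphere_ratio_cases)
  obtain x3 y3 where r: "r = sphere_ratio x3 y3" "x3 \<noteq> 0 \<or> y3 \<noteq> 0" by (rule sphere_ratio_cases)
  define k where "k = x2 * y3 - x3 * y2"
  define m where "m = x2 * y1 - x1 * y2"
  define s where "s = x1 * y3 - x3 * y1"
  have nz: "k \<noteq> 0" "m \<noteq> 0" "s \<noteq> 0"
    using assms p q r sphere_ratio_eq_iff unfolding k_def m_def s_def by auto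
  let ?f = "sphere_moebius (y1 * k) (- (x1 * k)) (y3 * m) (- (x3 * m))"
  have "(y1 * k) * (- (x3 * m)) - (- (x1 * k)) * (y3 * m) = k * m * s"
    unfolding s_def by (simp add: algebra_simps)
  then have det: "(y1 * k) * (- (x3 * m)) - (- (x1 * k)) * (y3 * m) \<noteq> 0" using nz by simp
  have "y1 * k * x1 + - (x1 * k) * y1 = 0" "y3 * m * x1 + - (x3 * m) * y1 = m * s"
    "y1 * k * x2 + - (x1 * k) * y2 = k * m" "y3 * m * x2 + - (x3 * m) * y2 = k * m"
    "y3 * m * x3 + - (x3 * m) * y3 = 0"
    unfolding k_def m_def s_def by (simp_all add: algebra_simps)
  then have "?f p = Some 0" "?f q = Some 1" "?f r = None"
    unfolding p(1) q(1) r(1) sphere_moebius_ratio[OF det p(2)] sphere_moebius_ratio[OF det q(2)]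
      sphere_moebius_ratio[OF det r(2)]
    using nz by (simp_all add: sphere_ratio_def)
  moreover have "is_moebius ?f" unfolding is_moebius_def using det by blast
  ultimately show ?thesis using that by blast
qed

text \<open>
  Moving the three common values to \<open>0, 1, \<infinity>\<close> reduces the claim to the case of a transformation
  that fixes these points.
\<close>

lemma is_moebius_eqI:
  assumes "is_moebius f" "is_moebius g" "p \<noteq> q" "q \<noteq> r" "p \<noteq> r"
    and "f p = g p" "f q = g q" "f r = g r"
  shows "f = g"
proof -
  have "g p \<noteq> g q" "g q \<noteq> g r" "g p \<noteq> g r"
    using is_moebius_inj[OF assms(2)] assms(3-5) by (auto dest: injD)
  then obtain h where h: "is_moebius h" "h (g p) = Some 0" "h (g q) = Some 1" "h (g r) = None"
    by (rule is_moebius_normalize)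
  have hg: "is_moebius (h \<circ> g)" "is_moebius (h \<circ> f)"
    using assms h by (auto intro: is_moebius_comp)
  obtain k where k: "is_moebius k" "k \<circ> (h \<circ> g) = id" using is_moebius_inverse[OF hg(1)] by blast
  have k0: "k (Some 0) = p" "k (Some 1) = q" "k None = r"
    using k(2) h(2-4) by (metis comp_apply id_apply)+
  have "h \<circ> f \<circ> k = id"
    using assms(6-8) h k0 by (intro is_moebius_fixing_0_1_inf is_moebius_comp hg k(1)) auto
  then have "h (f w) = h (g w)" for w
    using k(2) by (metis comp_apply id_apply)
  then show ?thesis using is_moebius_inj[OF h(1)] by (auto simp: fun_eq_iff dest: injD)
qed

section \<open>Configurations up to Moebius transformations\<close>

definition moebius_congruent ::
    "'a set \<Rightarrow> ('a \<Rightarrow> riemann_sphere) \<Rightarrow> ('a \<Rightarrow> riemann_sphere) \<Rightarrow> bool" where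
  "moebius_congruent I c c' \<longleftrightarrow> (\<exists>h. is_moebius h \<and> (\<forall>i\<in>I. c' i = h (c i)))"

lemma moebius_congruent_refl: "moebius_congruent I c c"
  unfolding moebius_congruent_def using is_moebius_id by (metis id_apply)

lemma moebius_congruent_sym:
  assumes "moebius_congruent I c c'"
  shows "moebius_congruent I c' c"
proof -
  obtain h where h: "is_moebius h" "\<forall>i\<in>I. c' i = h (c i)"
    using assms unfolding moebius_congruent_def by blast
  obtain k where k: "is_moebius k" "k \<circ> h = id" using is_moebius_inverse[OF h(1)] by blast
  then have "\<forall>i\<in>I. c i = k (c' i)" using h(2) by (metis comp_apply id_apply)
  with k(1) show ?thesis unfolding moebius_congruent_def by blast
qed

lemma moebius_congruent_trans:
  assumes "moebius_congruent I c c'" "moebius_congruent I c' c''"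
  shows "moebius_congruent I c c''"
proof -
  obtain h where h: "is_moebius h" "\<forall>i\<in>I. c' i = h (c i)"
    using assms(1) unfolding moebius_congruent_def by blast
  obtain k where k: "is_moebius k" "\<forall>i\<in>I. c'' i = k (c' i)"
    using assms(2) unfolding moebius_congruent_def by blast
  have "\<forall>i\<in>I. c'' i = (k \<circ> h) (c i)" using h k by simp
  with is_moebius_comp[OF k(1) h(1)] show ?thesis unfolding moebius_congruent_def by blast
qed

lemma moebius_congruent_reindex:
  assumes "moebius_congruent I c c'" "w ` I \<subseteq> I"
  shows "moebius_congruent I (c \<circ> w) (c' \<circ> w)"
  using assms unfolding moebius_congruent_def by (fastforce simp: image_subset_iff)

text \<open>
  If \<open>w p \<noteq> p\<close>, move the one point \<open>c (w p)\<close> while the others stay: the transformation is pinned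
  down by three points that do not notice the change, yet has to follow it.
\<close>

lemma moebius_congruent_faithful:
  fixes w :: "nat \<Rightarrow> nat"
  assumes "finite I" "card I \<ge> 5" "w permutes I"
    and all: "\<And>c. inj_on c I \<Longrightarrow> moebius_congruent I c (c \<circ> w)"
  shows "w = id"
proof (rule ccontr)
  assume "w \<noteq> id"
  then obtain p where p: "w p \<noteq> p" by (auto simp: fun_eq_iff)
  define q where "q = w p"
  have pI: "p \<in> I" using p assms(3) by (auto simp: permutes_def)
  have qI: "q \<in> I" using pI assms(3) by (simp add: q_def permutes_in_image)
  \<comment> \<open>Finite points for \<open>c\<close> leave infinity free as the new value at \<open>q\<close>.\<close>
  define c :: "nat \<Rightarrow> riemann_sphere" where "c i = Some (of_nat i)" for i
  define c' where "c' = c(q := None)"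
  have "inj_on c I" "inj_on c' I" by (auto simp: c'_def c_def inj_on_def)
  from this[THEN all] obtain f f' where f: "is_moebius f" "\<forall>i\<in>I. c (w i) = f (c i)"
      and f': "is_moebius f'" "\<forall>i\<in>I. c' (w i) = f' (c' i)"
    unfolding moebius_congruent_def comp_def by blast
  \<comment> \<open>Off \<open>p\<close> and \<open>q\<close>, neither the argument \<open>c i\<close> nor the value \<open>c (w i)\<close> sees the change at \<open>q\<close>.\<close>
  have agree: "f (c i) = f' (c i)" if "i \<in> I - {p, q}" for i
  proof -
    have "w i \<noteq> q" using that permutes_inj[OF assms(3)] by (auto simp: q_def dest: injD)
    then show ?thesis using that f(2) f'(2) by (auto simp: c'_def)
  qed
  have "card (I - {p, q}) = card I - card {p, q}"
    using pI qI assms(1) by (intro card_Diff_subset) auto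
  then have "card (I - {p, q}) \<ge> 3" using assms(2) p by (auto simp: q_def)
  then obtain T where "T \<subseteq> I - {p, q}" "card T = 3" by (meson obtain_subset_with_card_n)
  then obtain i j k where "{i, j, k} \<subseteq> I - {p, q}" "i \<noteq> j" "j \<noteq> k" "i \<noteq> k"
    by (auto simp: card_3_iff)
  then have "f = f'"
    using agree by (intro is_moebius_eqI[OF f(1) f'(1), of "c i" "c j" "c k"]) (auto simp: c_def)
  then have "c q = c' q" using f(2) f'(2) pI p by (auto simp: c'_def q_def)
  then show False by (simp add: c'_def c_def)
qed

section \<open>Points of \<open>K_space n\<close> as normal forms\<close>

text \<open>
  The inequalities that define \<open>K_space n\<close> say that the \<open>n\<close> marked points, including \<open>0, 1, \<infinity>\<close>, are
  distinct. In this form membership is visibly preserved by the injective Moebius transformations.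
\<close>

lemma K_space_iff_inj_on:
  assumes "n \<ge> 3"
  shows "l \<in> K_space n \<longleftrightarrow> l \<in> extensional {1..n-3} \<and> inj_on (z_point l) {1..n}"
proof
  assume l: "l \<in> K_space n"
  have "z_point l i \<noteq> z_point l j" if "i \<in> {1..n}" "j \<in> {1..n}" "i < j" for i j
  proof -
    have j: "l (j - 3) \<noteq> 0" "l (j - 3) \<noteq> 1" if "j > 3"
    proof -
      have "j - 3 \<in> {1..n-3}" using that \<open>j \<in> {1..n}\<close> by auto
      then show "l (j - 3) \<noteq> 0" "l (j - 3) \<noteq> 1" using l unfolding K_space_def by blast+
    qed
    have ij: "l (i - 3) \<noteq> l (j - 3)" if "i > 3"
    proof -
      have "i - 3 \<in> {1..n-3}" "j - 3 \<in> {1..n-3}" "i - 3 \<noteq> j - 3"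
        using that \<open>i \<in> {1..n}\<close> \<open>j \<in> {1..n}\<close> \<open>i < j\<close> by auto
      then show ?thesis using l unfolding K_space_def by blast
    qed
    show ?thesis using that j ij by (auto simp: z_point_def)
  qed
  then have "inj_on (z_point l) {1..n}" by (meson linorder_inj_onI')
  then show "l \<in> extensional {1..n-3} \<and> inj_on (z_point l) {1..n}"
    using l by (auto simp: K_space_def PiE_def)
next
  assume l: "l \<in> extensional {1..n-3} \<and> inj_on (z_point l) {1..n}"
  have z: "z_point l (i + 3) = Some (l i)" if "i \<in> {1..n-3}" for i
    using that by (simp add: z_point_def)
  have ne: "z_point l i \<noteq> z_point l j" if "i \<in> {1..n}" "j \<in> {1..n}" "i \<noteq> j" for i j
    using l that by (meson inj_onD)
  have shift: "i + 3 \<in> {1..n}" if "i \<in> {1..n-3}" for i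
    using that assms by (simp, linarith)
  have "l i \<noteq> 0 \<and> l i \<noteq> 1" if i: "i \<in> {1..n-3}" for i
  proof -
    have "z_point l (i + 3) \<noteq> z_point l 1" "z_point l (i + 3) \<noteq> z_point l 2"
      using i assms by (intro ne shift; simp)+
    moreover have "z_point l 1 = Some 0" "z_point l 2 = Some 1" by (simp_all add: z_point_def)
    ultimately show ?thesis using z[OF i] by metis
  qed
  moreover have "l i \<noteq> l j" if ij: "i \<in> {1..n-3}" "j \<in> {1..n-3}" "i \<noteq> j" for i j
  proof -
    have "z_point l (i + 3) \<noteq> z_point l (j + 3)"
      using ij by (intro ne shift) simp_all
    then show ?thesis using z[OF ij(1)] z[OF ij(2)] by metis
  qed
  moreover have "l \<in> {1..n-3} \<rightarrow>\<^sub>E UNIV" using l by (simp add: PiE_def)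
  ultimately show "l \<in> K_space n" unfolding K_space_def by blast
qed

text \<open>
  The tuple \<open>m\<close> has the shape in which \<open>g_map\<close> is defined, so this lemma serves both the existence
  of normal forms and the description of \<open>g_map\<close>. Injectivity of \<open>h\<close> keeps the points other than
  \<open>c 3\<close> away from infinity, where \<open>the\<close> would lose them.
\<close>

lemma normal_form_from_moebius:
  assumes "n \<ge> 3" "inj_on c {1..n}" "is_moebius h"
    and "h (c 1) = Some 0" "h (c 2) = Some 1" "h (c 3) = None"
  defines "m \<equiv> \<lambda>i\<in>{1..n-3}. the (h (c (i + 3)))"
  shows "m \<in> K_space n" "moebius_congruent {1..n} c (z_point m)"
proof -
  have z: "z_point m i = h (c i)" if i: "i \<in> {1..n}" for i
  proof (cases "i \<le> 3")
    case True
    then have "i = 1 \<or> i = 2 \<or> i = 3" using i by auto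
    then show ?thesis using assms(4-6) by (auto simp: z_point_def)
  next
    case False
    have "c i \<noteq> c 3" using False i assms(1,2) by (simp add: inj_on_eq_iff)
    then have "h (c i) \<noteq> None" using is_moebius_inj[OF assms(3)] assms(6) by (metis injD)
    then show ?thesis using False i by (auto simp: z_point_def m_def)
  qed
  then show "moebius_congruent {1..n} c (z_point m)"
    unfolding moebius_congruent_def using assms(3) by blast
  have "inj_on (h \<circ> c) {1..n}"
    using assms(2) inj_on_subset[OF is_moebius_inj[OF assms(3)] subset_UNIV] by (rule comp_inj_on)
  then have "inj_on (z_point m) {1..n}"
    by (rule iffD1[OF inj_on_cong, rotated]) (simp add: z)
  then show "m \<in> K_space n" using assms(1) by (simp add: K_space_iff_inj_on m_def)
qed

lemma distinct_first_three:
  fixes c :: "nat \<Rightarrow> 'a"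
  assumes "n \<ge> 3" "inj_on c {1..n}"
  shows "c 1 \<noteq> c 2" "c 2 \<noteq> c 3" "c 1 \<noteq> c 3"
  using assms by (simp_all add: inj_on_eq_iff)

lemma normal_form_exists:
  assumes "n \<ge> 3" "inj_on c {1..n}"
  obtains m where "m \<in> K_space n" "moebius_congruent {1..n} c (z_point m)"
proof -
  obtain h where "is_moebius h" "h (c 1) = Some 0" "h (c 2) = Some 1" "h (c 3) = None"
    using is_moebius_normalize distinct_first_three[OF assms] by metis
  from normal_form_from_moebius[OF assms this] show ?thesis by (rule that)
qed

text \<open>A transformation between two normal forms fixes \<open>0, 1, \<infinity>\<close>, hence is the identity.\<close>

lemma normal_form_unique:
  assumes "n \<ge> 3" "l \<in> K_space n" "m \<in> K_space n"
    and "moebius_congruent {1..n} (z_point l) (z_point m)"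
  shows "l = m"
proof -
  obtain h where h: "is_moebius h" "\<forall>i\<in>{1..n}. z_point m i = h (z_point l i)"
    using assms(4) unfolding moebius_congruent_def by blast
  have "h (Some 0) = Some 0" "h (Some 1) = Some 1" "h None = None"
    using bspec[OF h(2), of 1] bspec[OF h(2), of 2] bspec[OF h(2), of 3] assms(1)
    by (auto simp: z_point_def)
  then have "h = id" using h(1) by (intro is_moebius_fixing_0_1_inf)
  have "l i = m i" if "i \<in> {1..n-3}" for i
    using bspec[OF h(2), of "i + 3"] that \<open>h = id\<close> by (auto simp: z_point_def)
  moreover have "l \<in> extensional {1..n-3}" "m \<in> extensional {1..n-3}"
    using assms by (auto simp: K_space_iff_inj_on)
  ultimately show ?thesis by (intro extensionalityI)
qed

section \<open>The action of permutations\<close>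

text \<open>
  Sharp 3-transitivity resolves the definite description in \<open>f_moebius\<close>. With \<open>g_map_eqI\<close> below,
  this characterizes the values of \<open>g_map\<close> on \<open>K_space n\<close> by congruence alone.
\<close>

lemma g_map_normal_form:
  assumes "n \<ge> 3" "\<sigma> permutes {1..n}" "l \<in> K_space n"
  shows "g_map n \<sigma> l \<in> K_space n"
    and "moebius_congruent {1..n} (z_point l \<circ> inv_into UNIV \<sigma>) (z_point (g_map n \<sigma> l))"
proof -
  let ?c = "z_point l \<circ> inv_into UNIV \<sigma>"
  have "inj_on (z_point l) {1..n}" using assms by (simp add: K_space_iff_inj_on)
  then have inj: "inj_on ?c {1..n}"
    using permutes_inv[OF assms(2)]
    by (metis comp_inj_on permutes_image permutes_inj_on)
  obtain h where h: "is_moebius h" "h (?c 1) = Some 0" "h (?c 2) = Some 1" "h (?c 3) = None"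
    using is_moebius_normalize distinct_first_three[OF assms(1) inj] by metis
  have "f_moebius \<sigma> l = h"
    unfolding f_moebius_def
  proof (rule the_equality)
    fix k
    assume k: "is_moebius k \<and> k (z_point l (inv_into UNIV \<sigma> 1)) = Some 0 \<and>
      k (z_point l (inv_into UNIV \<sigma> 2)) = Some 1 \<and> k (z_point l (inv_into UNIV \<sigma> 3)) = None"
    show "k = h"
      using k h distinct_first_three[OF assms(1) inj]
      by (intro is_moebius_eqI[of k h "?c 1" "?c 2" "?c 3"]) auto
  qed (use h in auto)
  then have g: "g_map n \<sigma> l = (\<lambda>i\<in>{1..n-3}. the (h (?c (i + 3))))"
    using assms(3) by (simp add: g_map_def)
  show "g_map n \<sigma> l \<in> K_space n" "moebius_congruent {1..n} ?c (z_point (g_map n \<sigma> l))"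
    unfolding g by (rule normal_form_from_moebius[OF assms(1) inj h])+
qed

lemma g_map_eqI:
  assumes "n \<ge> 3" "\<sigma> permutes {1..n}" "l \<in> K_space n" "m \<in> K_space n"
    and "moebius_congruent {1..n} (z_point l \<circ> inv_into UNIV \<sigma>) (z_point m)"
  shows "g_map n \<sigma> l = m"
  using normal_form_unique[OF assms(1) _ assms(4)] g_map_normal_form[OF assms(1-3)] assms(5)
    moebius_congruent_sym moebius_congruent_trans by meson

lemma g_map_id:
  assumes "n \<ge> 3"
  shows "g_map n id = (\<lambda>l\<in>K_space n. l)"
proof
  fix l
  show "g_map n id l = (\<lambda>l\<in>K_space n. l) l"
    using g_map_eqI[OF assms permutes_id, of l l]
    by (cases "l \<in> K_space n") (simp_all add: moebius_congruent_refl, simp add: g_map_def)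
qed

text \<open>
  The inverse in the definition of \<open>g_map\<close> makes precomposition a left action, so the order of the
  factors is preserved.
\<close>

lemma g_map_comp:
  assumes "n \<ge> 3" "\<sigma> permutes {1..n}" "\<tau> permutes {1..n}"
  shows "g_map n (\<sigma> \<circ> \<tau>) = compose (K_space n) (g_map n \<sigma>) (g_map n \<tau>)"
proof
  fix l
  show "g_map n (\<sigma> \<circ> \<tau>) l = compose (K_space n) (g_map n \<sigma>) (g_map n \<tau>) l"
  proof (cases "l \<in> K_space n")
    case True
    note nf = g_map_normal_form[OF assms(1,3) True]
    note nf' = g_map_normal_form[OF assms(1,2) nf(1)]
    have inv: "inv_into UNIV (\<sigma> \<circ> \<tau>) = inv_into UNIV \<tau> \<circ> inv_into UNIV \<sigma>"
      using assms(2,3) by (intro o_inv_distrib permutes_bij)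
    have "moebius_congruent {1..n} (z_point l \<circ> inv_into UNIV \<tau> \<circ> inv_into UNIV \<sigma>)
            (z_point (g_map n \<tau> l) \<circ> inv_into UNIV \<sigma>)"
      using nf(2) permutes_image[OF permutes_inv[OF assms(2)]]
      by (intro moebius_congruent_reindex) auto
    then have "moebius_congruent {1..n} (z_point l \<circ> inv_into UNIV (\<sigma> \<circ> \<tau>))
            (z_point (g_map n \<sigma> (g_map n \<tau> l)))"
      using moebius_congruent_trans[OF _ nf'(2)] by (simp only: inv comp_assoc)
    then have "g_map n (\<sigma> \<circ> \<tau>) l = g_map n \<sigma> (g_map n \<tau> l)"
      using assms True nf'(1) by (intro g_map_eqI permutes_compose)
    then show ?thesis using True by (simp add: compose_def)
  qed (simp add: g_map_def compose_def)
qed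

lemma g_map_Bij:
  assumes "n \<ge> 3" "\<sigma> permutes {1..n}"
  shows "g_map n \<sigma> \<in> Bij (K_space n)"
proof -
  note inv = permutes_inv[OF assms(2)]
  have "g_map n \<sigma> (g_map n (inv_into UNIV \<sigma>) l) = l"
    "g_map n (inv_into UNIV \<sigma>) (g_map n \<sigma> l) = l" if "l \<in> K_space n" for l
    using that g_map_comp[OF assms(1) assms(2) inv] g_map_comp[OF assms(1) inv assms(2)]
      g_map_id[OF assms(1)] permutes_inv_o[OF assms(2)]
    by (simp_all add: fun_eq_iff compose_def) metis+
  then have "bij_betw (g_map n \<sigma>) (K_space n) (K_space n)"
    using g_map_normal_form(1)[OF assms] g_map_normal_form(1)[OF assms(1) inv]
    by (intro bij_betwI[where g = "g_map n (inv_into UNIV \<sigma>)"]) auto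
  then show ?thesis by (simp add: Bij_def g_map_def)
qed

lemma g_map_group_hom:
  assumes "n \<ge> 3"
  shows "group_hom (sym_group n) (BijGroup (K_space n)) (g_map n)"
proof (intro group_hom.intro group_hom_axioms.intro homI)
  show "group (sym_group n)" "group (BijGroup (K_space n))"
    by (simp_all add: sym_group_is_group group_BijGroup)
next
  fix \<sigma> assume "\<sigma> \<in> carrier (sym_group n)"
  then show "g_map n \<sigma> \<in> carrier (BijGroup (K_space n))"
    using g_map_Bij[OF assms] by (simp add: sym_group_def BijGroup_def)
next
  fix \<sigma> \<tau> assume "\<sigma> \<in> carrier (sym_group n)" "\<tau> \<in> carrier (sym_group n)"
  then show "g_map n (\<sigma> \<otimes>\<^bsub>sym_group n\<^esub> \<tau>) = g_map n \<sigma> \<otimes>\<^bsub>BijGroup (K_space n)\<^esub> g_map n \<tau>"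
    using g_map_comp[OF assms] g_map_Bij[OF assms] by (simp add: sym_group_def BijGroup_def)
qed

text \<open>
  The hypothesis concerns normal forms only; as each injective configuration is congruent to one,
  it extends to all of them, and \<open>moebius_congruent_faithful\<close> applies.
\<close>

lemma g_map_kernel_trivial:
  assumes "n \<ge> 5" "\<sigma> permutes {1..n}" "g_map n \<sigma> = (\<lambda>l\<in>K_space n. l)"
  shows "\<sigma> = id"
proof -
  have n: "n \<ge> 3" using assms(1) by simp
  let ?w = "inv_into UNIV \<sigma>"
  have w: "?w permutes {1..n}" using assms(2) by (rule permutes_inv)
  have "moebius_congruent {1..n} c (c \<circ> ?w)" if c: "inj_on c {1..n}" for c
  proof -
    obtain l where l: "l \<in> K_space n" "moebius_congruent {1..n} c (z_point l)"
      using normal_form_exists[OF n c] by blast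
    have "moebius_congruent {1..n} (z_point l \<circ> ?w) (z_point l)"
      using g_map_normal_form(2)[OF n assms(2) l(1)] assms(3) l(1) by simp
    moreover have "moebius_congruent {1..n} (c \<circ> ?w) (z_point l \<circ> ?w)"
      using l(2) permutes_image[OF w] by (intro moebius_congruent_reindex) auto
    ultimately show ?thesis using l(2) by (meson moebius_congruent_sym moebius_congruent_trans)
  qed
  then have "?w = id" using w assms(1) by (intro moebius_congruent_faithful) auto
  then show ?thesis using permutes_inv_o[OF assms(2)] by simp
qed

theorem theorem3:
  fixes n :: nat
  assumes "n \<ge> 5"
  shows "subgroup (G_set n) (BijGroup (K_space n)) \<and> G_group n \<cong> sym_group n"
proof -
  let ?B = "BijGroup (K_space n)"
  interpret g: group_hom "sym_group n" ?B "g_map n"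
    using assms by (intro g_map_group_hom) simp
  have G: "G_set n = g_map n ` carrier (sym_group n)"
    by (auto simp: G_set_def sym_group_def)
  have "kernel (sym_group n) ?B (g_map n) = {\<one>\<^bsub>sym_group n\<^esub>}"
    using g_map_kernel_trivial[OF assms] g_map_id assms
    by (auto simp: kernel_def sym_group_def BijGroup_def permutes_id)
  then have "inj_on (g_map n) (carrier (sym_group n))" by (simp add: g.inj_iff_trivial_ker)
  then have "g_map n \<in> iso (sym_group n) (G_group n)"
    using g.homh unfolding iso_def hom_def G_group_def G bij_betw_def by auto
  then have "G_group n \<cong> sym_group n"
    using g.G.iso_sym by (auto simp: is_iso_def)
  moreover have "subgroup (G_set n) ?B"
    unfolding G by (rule g.img_is_subgroup)
  ultimately show ?thesis by simp
qed

end
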